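(* Let $n\ge 2$ and $1\le r\le n-1$. Then $\mathrm{Aut}(T_{n,r})$ is a subgroup of $\mathrm{Aut}(G_{n,r})$, where $\mathrm{Aut}(T_{n,r})$ and $\mathrm{Aut}(G_{n,r})$ are identified with the normalisers $N_{H(\mathfrak C_{n,r})}(T_{n,r})$ and $N_{H(\mathfrak C_{n,r})}(G_{n,r})$ respectively; that is, $N_{H(\mathfrak C_{n,r})}(T_{n,r})\le N_{H(\mathfrak C_{n,r})}(G_{n,r})$.
   Context: Maps act on the right. $X_n=\{0,\ldots,n-1\}$, $X_n^*$ is the set of finite words over $X_n$, $\dot{\mathbf r}=\{\dot 0,\ldots,\dot{(r-1)}\}$ is a further ordered alphabet, $X_{n,r}^+=\{\dot a w:\dot a\in\dot{\mathbf r},\,w\in X_n^*\}$, $\mathfrak C_n=X_n^\omega$, and $\mathfrak C_{n,r}=\{\dot a x:\dot a\in\dot{\mathbf r},\,x\in\mathfrak C_n\}$ is a Cantor space; $U_\nu$ is the set of infinite words with prefix $\nu$. $H(\mathfrak C_{n,r})$ is the group of homeomorphisms of $\mathfrak C_{n,r}$. A complete antichain is a finite set of pairwise prefix-incomparable words $u\in X_{n,r}^+$ whose sets $U_u$ cover $\mathfrak C_{n,r}$; it is listed in lexicographic order. $G_{n,r}\le H(\mathfrak C_{n,r})$ consists of all homeomorphisms $g$ for which there are complete antichains $\{u_0,\ldots,u_{l-1}\}$, $\{v_0,\ldots,v_{l-1}\}$ of the same size and a bijection $\pi$ between them with $(u_i x)g=(u_i)\pi\, x$ for all $i$ and $x\in\mathfrak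 C_n$. $T_{n,r}\le G_{n,r}$ consists of those $g$ for which $\pi$ can be taken of the form $(u_i)\pi=v_{(i+j)\bmod l}$ for a fixed $j$. The identifications: $N_{H(\mathfrak C_{n,r})}(T_{n,r})\cong\mathrm{Aut}(T_{n,r})$ and $N_{H(\mathfrak C_{n,r})}(G_{n,r})\cong\mathrm{Aut}(G_{n,r})$ via the conjugation action. *)

theory Defs
  imports
    "HOL-Analysis.Analysis"
    "HOL-Algebra.Algebra"
    "HOL-Library.Sublist"
    "HOL-Library.Omega_Words_Fun"
begin

text \<open>
  The alphabet \<open>X\<^sub>n\<close> is \<open>{..<n}\<close>. The dotted alphabet is \<open>{..<r}\<close>; dotted letters
  are kept apart from undotted ones by pairing, so the word (a-dot)w is the pair \<open>(a, w)\<close>,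
  for finite and for infinite \<open>w\<close> alike.
\<close>

definition omega_words :: "nat \<Rightarrow> (nat \<Rightarrow> nat) set" where
  "omega_words n = (UNIV \<rightarrow> {..<n})"

definition cantor :: "nat \<Rightarrow> nat \<Rightarrow> (nat \<times> (nat \<Rightarrow> nat)) set" where
  "cantor n r = {..<r} \<times> omega_words n"

definition cantor_space :: "nat \<Rightarrow> nat \<Rightarrow> (nat \<times> (nat \<Rightarrow> nat)) topology" where
  "cantor_space n r =
     prod_topology (discrete_topology {..<r})
       (product_topology (\<lambda>_. discrete_topology {..<n}) UNIV)"

lemma topspace_cantor_space: "topspace (cantor_space n r) = cantor n r"
  by (simp add: cantor_space_def cantor_def omega_words_def PiE_def)

definition rooted_words :: "nat \<Rightarrow> nat \<Rightarrow> (nat \<times> nat list) set" where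
  "rooted_words n r = {..<r} \<times> lists {..<n}"

definition rooted_prefix :: "nat \<times> nat list \<Rightarrow> nat \<times> nat list \<Rightarrow> bool" where
  "rooted_prefix u v \<longleftrightarrow> fst u = fst v \<and> Sublist.prefix (snd u) (snd v)"

definition rooted_conc :: "nat \<times> nat list \<Rightarrow> (nat \<Rightarrow> nat) \<Rightarrow> nat \<times> (nat \<Rightarrow> nat)" where
  "rooted_conc u x = (fst u, snd u \<frown> x)"

definition cone :: "nat \<Rightarrow> nat \<times> nat list \<Rightarrow> (nat \<times> (nat \<Rightarrow> nat)) set" where
  "cone n u = rooted_conc u ` omega_words n"

definition complete_antichain :: "nat \<Rightarrow> nat \<Rightarrow> (nat \<times> nat list) set \<Rightarrow> bool" where
  "complete_antichain n r A \<longleftrightarrow>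
     finite A \<and> A \<subseteq> rooted_words n r \<and>
     (\<forall>u\<in>A. \<forall>v\<in>A. u \<noteq> v \<longrightarrow> \<not> rooted_prefix u v) \<and>
     (\<Union>u\<in>A. cone n u) = cantor n r"

definition lex_less :: "nat \<times> nat list \<Rightarrow> nat \<times> nat list \<Rightarrow> bool" where
  "lex_less u v \<longleftrightarrow> (u, v) \<in> less_than <*lex*> lexord less_than"

definition lex_listing :: "(nat \<times> nat list) list \<Rightarrow> (nat \<times> nat list) set \<Rightarrow> bool" where
  "lex_listing us A \<longleftrightarrow> set us = A \<and> sorted_wrt lex_less us"

text \<open>
  Maps act on the right: \<open>f \<otimes> g\<close> is first \<open>f\<close>, then \<open>g\<close>. Homeomorphisms are
  taken extensional, so that equality of group elements is equality on the Cantor space.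
\<close>

definition homeo_group :: "nat \<Rightarrow> nat \<Rightarrow> (nat \<times> (nat \<Rightarrow> nat) \<Rightarrow> nat \<times> (nat \<Rightarrow> nat)) monoid" where
  "homeo_group n r =
     \<lparr>carrier = {f \<in> extensional (cantor n r).
                   homeomorphic_map (cantor_space n r) (cantor_space n r) f},
      mult = (\<lambda>f g. compose (cantor n r) g f),
      one = (\<lambda>x\<in>cantor n r. x)\<rparr>"

lemma group_homeo_group: "group (homeo_group n r)"
proof (rule groupI)
  let ?C = "cantor n r" and ?X = "cantor_space n r"
  note [simp] = homeo_group_def topspace_cantor_space
  have into: "f x \<in> ?C" if "f \<in> carrier (homeo_group n r)" "x \<in> ?C" for f x
    using that homeomorphic_imp_surjective_map[of ?X ?X f] by auto
  have eq: "homeomorphic_map ?X ?X g" if "homeomorphic_map ?X ?X f" "\<And>x. x \<in> ?C \<Longrightarrow> f x = g x" for f g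
    using homeomorphic_map_eq[OF that(1)] that(2) by simp
  show "f \<otimes>\<^bsub>homeo_group n r\<^esub> g \<in> carrier (homeo_group n r)"
    if "f \<in> carrier (homeo_group n r)" "g \<in> carrier (homeo_group n r)" for f g
    using that eq[of "g \<circ> f" "compose ?C g f"]
    by (auto simp: compose_def intro: homeomorphic_map_compose)
  show "\<one>\<^bsub>homeo_group n r\<^esub> \<in> carrier (homeo_group n r)"
    using eq[of id "\<lambda>x\<in>?C. x"] by simp
  show "f \<otimes>\<^bsub>homeo_group n r\<^esub> g \<otimes>\<^bsub>homeo_group n r\<^esub> h
      = f \<otimes>\<^bsub>homeo_group n r\<^esub> (g \<otimes>\<^bsub>homeo_group n r\<^esub> h)"
    if "f \<in> carrier (homeo_group n r)" "g \<in> carrier (homeo_group n r)"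
       "h \<in> carrier (homeo_group n r)" for f g h
    using into[OF that(1)] by (auto simp: compose_def fun_eq_iff)
  show "\<one>\<^bsub>homeo_group n r\<^esub> \<otimes>\<^bsub>homeo_group n r\<^esub> f = f"
    if "f \<in> carrier (homeo_group n r)" for f
    using that by (auto simp: compose_def extensional_def fun_eq_iff)
  show "\<exists>g\<in>carrier (homeo_group n r). g \<otimes>\<^bsub>homeo_group n r\<^esub> f = \<one>\<^bsub>homeo_group n r\<^esub>"
    if f: "f \<in> carrier (homeo_group n r)" for f
  proof -
    obtain g where g: "homeomorphic_maps ?X ?X f g"
      using f by (auto simp: homeomorphic_map_maps)
    then have "homeomorphic_map ?X ?X (restrict g ?C)"
      using eq[of g "restrict g ?C"]
      by (simp add: homeomorphic_maps_map)
    moreover have "f (g x) = x" if "x \<in> ?C" for x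
      using g that by (simp add: homeomorphic_maps_def)
    ultimately show ?thesis
      by (intro bexI[of _ "restrict g ?C"]) (auto simp: compose_def fun_eq_iff)
  qed
qed

definition prefix_exchange ::
  "nat \<Rightarrow> (nat \<times> nat list) set \<Rightarrow> (nat \<times> nat list \<Rightarrow> nat \<times> nat list) \<Rightarrow>
     (nat \<times> (nat \<Rightarrow> nat) \<Rightarrow> nat \<times> (nat \<Rightarrow> nat)) \<Rightarrow> bool" where
  "prefix_exchange n A \<pi> g \<longleftrightarrow>
     (\<forall>u\<in>A. \<forall>x\<in>omega_words n. g (rooted_conc u x) = rooted_conc (\<pi> u) x)"

definition Higman_G :: "nat \<Rightarrow> nat \<Rightarrow> (nat \<times> (nat \<Rightarrow> nat) \<Rightarrow> nat \<times> (nat \<Rightarrow> nat)) set" where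
  "Higman_G n r =
     {g \<in> carrier (homeo_group n r).
        \<exists>A B \<pi>. complete_antichain n r A \<and> complete_antichain n r B \<and>
          bij_betw \<pi> A B \<and> prefix_exchange n A \<pi> g}"

definition Higman_T :: "nat \<Rightarrow> nat \<Rightarrow> (nat \<times> (nat \<Rightarrow> nat) \<Rightarrow> nat \<times> (nat \<Rightarrow> nat)) set" where
  "Higman_T n r =
     {g \<in> carrier (homeo_group n r).
        \<exists>A B \<pi> us vs j. complete_antichain n r A \<and> complete_antichain n r B \<and>
          bij_betw \<pi> A B \<and> prefix_exchange n A \<pi> g \<and>
          lex_listing us A \<and> lex_listing vs B \<and>
          (\<forall>i<length us. \<pi> (us ! i) = vs ! ((i + j) mod length us))}"

lemma Higman_T_subset_G: "Higman_T n r \<subseteq> Higman_G n r"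
  unfolding Higman_T_def Higman_G_def by blast

lemma Higman_G_subset: "Higman_G n r \<subseteq> carrier (homeo_group n r)"
  unfolding Higman_G_def by blast

end

theory Submission
  imports Defs
begin

text \<open>
  $G_{n,r}$ is the full group of $T_{n,r}$: a homeomorphism lies in $G_{n,r}$ if and only if
  near every point it agrees with some element of $T_{n,r}$. Indeed any replacement
  $ux \mapsto vx$ of prefixes other than single dotted letters extends to an element of $T_{n,r}$,
  by rotating between two complete antichains of equal size containing $u$ and $v$; conversely,
  compactness turns local prefix replacements into finitely many cones. If $h$ normalises
  $T_{n,r}$ and $g$ locally agrees with elements of $T_{n,r}$, then so does $hgh^{-1}$.
\<close>

section \<open>Infinite words, cones and comparability of finite words\<close>

lemma omega_words_iff: "x \<in> omega_words n \<longleftrightarrow> (\<forall>i. x i < n)"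
  by (auto simp: omega_words_def)

lemma conc_mem_omega_words:
  assumes "w \<in> lists {..<n}"
  shows "w \<frown> x \<in> omega_words n \<longleftrightarrow> x \<in> omega_words n"
proof -
  have w: "w ! i < n" if "i < length w" for i
    using assms nth_mem[OF that] by auto
  have "x i < n" if "\<forall>i. (w \<frown> x) i < n" for i
    using that[rule_format, of "length w + i"] by simp
  then show ?thesis
    using w by (auto simp: omega_words_iff conc_def)
qed

lemma suffix_mem_omega_words: "x \<in> omega_words n \<Longrightarrow> suffix k x \<in> omega_words n"
  by (simp add: omega_words_iff)

lemma prefix_mem_lists: "x \<in> omega_words n \<Longrightarrow> prefix k x \<in> lists {..<n}"
  by (auto simp: omega_words_iff)

lemma omega_words_nonempty: "0 < n \<Longrightarrow> (\<lambda>_. 0) \<in> omega_words n"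
  by (simp add: omega_words_iff)

lemma prefix_length_conc: "prefix (length w) (w \<frown> x) = w"
  by (auto intro: nth_equalityI)

lemma prefix_conc_longer: "prefix (length w + k) (w \<frown> x) = w @ prefix k x"
  by (auto intro!: nth_equalityI simp: nth_append)

lemma rooted_conc_mem_cantor:
  assumes "u \<in> rooted_words n r"
  shows "rooted_conc u x \<in> cantor n r \<longleftrightarrow> x \<in> omega_words n"
proof -
  have u: "fst u < r" "snd u \<in> lists {..<n}" using assms by (auto simp: rooted_words_def)
  then show ?thesis
    using conc_mem_omega_words[OF u(2)] by (simp add: rooted_conc_def cantor_def)
qed

lemma rooted_conc_inject: "rooted_conc u x = rooted_conc u y \<longleftrightarrow> x = y"
proof
  assume "rooted_conc u x = rooted_conc u y"
  then have *: "snd u \<frown> x = snd u \<frown> y" by (simp add: rooted_conc_def)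
  show "x = y"
  proof
    fix k
    show "x k = y k" using fun_cong[OF *, of "length (snd u) + k"] by simp
  qed
qed auto

text \<open>The tail is recovered by deleting the initial letters, so no existential over tails
  remains and membership becomes a condition on finitely many letters.\<close>

lemma mem_cone_iff:
  assumes "u \<in> rooted_words n r"
  shows "p \<in> cone n u \<longleftrightarrow>
    p \<in> cantor n r \<and> fst p = fst u \<and> prefix (length (snd u)) (snd p) = snd u"
proof safe
  assume "p \<in> cone n u"
  then show "p \<in> cantor n r" "fst p = fst u" "prefix (length (snd u)) (snd p) = snd u"
    using rooted_conc_mem_cantor[OF assms]
    by (auto simp: cone_def prefix_length_conc) (auto simp: rooted_conc_def prefix_length_conc)
next
  assume p: "p \<in> cantor n r" "fst p = fst u" "prefix (length (snd u)) (snd p) = snd u"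
  then have "p = rooted_conc u (suffix (length (snd u)) (snd p))"
    using prefix_suffix[of "snd p" "length (snd u)"] by (simp add: rooted_conc_def prod_eq_iff)
  moreover have "suffix (length (snd u)) (snd p) \<in> omega_words n"
    using p by (auto simp: cantor_def suffix_mem_omega_words)
  ultimately show "p \<in> cone n u" by (auto simp: cone_def)
qed

lemma cone_subset_cantor: "u \<in> rooted_words n r \<Longrightarrow> cone n u \<subseteq> cantor n r"
  by (auto simp: mem_cone_iff)

lemma cone_mono:
  assumes "rooted_prefix u v" "v \<in> rooted_words n r"
  shows "cone n v \<subseteq> cone n u"
proof -
  from assms obtain w where w: "v = (fst u, snd u @ w)"
    by (auto simp: rooted_prefix_def Sublist.prefix_def prod_eq_iff)
  then have l: "w \<in> lists {..<n}" using assms by (auto simp: rooted_words_def)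
  then have "rooted_conc v x \<in> cone n u" if "x \<in> omega_words n" for x
    using that w conc_mem_omega_words[OF l]
    by (auto simp: cone_def rooted_conc_def intro!: image_eqI[of _ _ "w \<frown> x"])
  then show ?thesis by (auto simp: cone_def)
qed

text \<open>After the common dotted letter, both words are initial segments of the same infinite
  word \<open>snd p\<close>, and the shorter of two such segments begins the longer.\<close>

lemma cone_inter_comparable:
  assumes "p \<in> cone n u" "p \<in> cone n v" "u \<in> rooted_words n r" "v \<in> rooted_words n r"
  shows "rooted_prefix u v \<or> rooted_prefix v u"
proof -
  have *: "fst p = fst u" "prefix (length (snd u)) (snd p) = snd u"
    "fst p = fst v" "prefix (length (snd v)) (snd p) = snd v"
    using assms by (auto simp: mem_cone_iff[of _ n r])
  \<comment> \<open>Two notions of prefix meet here: \<open>prefix i x\<close> cuts the infinite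
    word \<open>x\<close> to its first \<open>i\<close> letters, while \<open>Sublist.prefix\<close>
    is the order on finite words.\<close>
  have "Sublist.prefix (prefix i x) (prefix j x)" if "i \<le> j" for i j :: nat and x :: "nat \<Rightarrow> nat"
    using that subsequence_append[of x i "j - i"] by simp
  then show ?thesis
    using * unfolding rooted_prefix_def by (metis nle_le)
qed

lemma rooted_prefix_refl: "rooted_prefix u u"
  by (simp add: rooted_prefix_def)

lemma rooted_prefix_trans: "rooted_prefix u v \<Longrightarrow> rooted_prefix v w \<Longrightarrow> rooted_prefix u w"
  by (auto simp: rooted_prefix_def)

lemma cone_prefix:
  assumes "p \<in> cantor n r"
  shows "(fst p, prefix k (snd p)) \<in> rooted_words n r" "p \<in> cone n (fst p, prefix k (snd p))"
proof -
  show *: "(fst p, prefix k (snd p)) \<in> rooted_words n r"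
    using assms prefix_mem_lists[of "snd p" n k] by (auto simp: rooted_words_def cantor_def)
  show "p \<in> cone n (fst p, prefix k (snd p))"
    using assms by (simp add: mem_cone_iff[OF *])
qed

section \<open>The topology of the Cantor space in terms of cones\<close>

text \<open>Besides fixing the dotted letter, a cone is a box that restricts only the first
  \<open>length (snd u)\<close> coordinates, each to a single letter.\<close>

lemma openin_cone:
  assumes "u \<in> rooted_words n r"
  shows "openin (cantor_space n r) (cone n u)"
proof -
  let ?Y = "\<lambda>i. if i < length (snd u) then {snd u ! i} else {..<n}"
  have u: "fst u < r" "snd u \<in> lists {..<n}" using assms by (auto simp: rooted_words_def)
  have nth: "snd u ! i < n" if "i < length (snd u)" for i
    using u nth_mem[OF that] by (auto simp: in_lists_conv_set)
  have "p \<in> cone n u \<longleftrightarrow> p \<in> {fst u} \<times> PiE UNIV ?Y" for p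
  proof -
    have 1: "prefix (length (snd u)) (snd p) = snd u \<longleftrightarrow> (\<forall>i<length (snd u). snd p i = snd u ! i)"
      unfolding list_eq_iff_nth_eq by simp
    have 2: "snd p i \<in> ?Y i \<longleftrightarrow> snd p i < n \<and> (i < length (snd u) \<longrightarrow> snd p i = snd u ! i)" for i
      by (cases "i < length (snd u)") (use nth[of i] in auto)
    have "snd p \<in> PiE UNIV ?Y \<longleftrightarrow> (\<forall>i. snd p i \<in> ?Y i)"
      by (simp add: PiE_UNIV_domain Pi_iff)
    then show ?thesis
      unfolding mem_cone_iff[OF assms] 1 2 mem_Times_iff cantor_def omega_words_iff
      using u(1) by auto
  qed
  then have "cone n u = {fst u} \<times> PiE UNIV ?Y" by blast
  moreover have "openin (product_topology (\<lambda>_. discrete_topology {..<n}) UNIV) (PiE UNIV ?Y)"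
  proof (rule product_topology_basis)
    show "finite {i. ?Y i \<noteq> topspace (discrete_topology {..<n})}"
      by (rule finite_subset[of _ "{..<length (snd u)}"]) (auto split: if_splits)
    show "openin (discrete_topology {..<n}) (?Y i)" for i
      by (cases "i < length (snd u)") (use nth[of i] in auto)
  qed
  ultimately show ?thesis
    using u(1) by (simp add: cantor_space_def openin_prod_Times_iff)
qed

text \<open>A basic open box around \<open>p\<close> constrains only finitely many coordinates. Any
  \<open>k\<close> beyond all of them works, since points of the cone share the first
  \<open>k\<close> letters of \<open>p\<close> and are unconstrained afterwards.\<close>

lemma openin_cantor_space_cone:
  assumes "openin (cantor_space n r) U" "p \<in> U"
  obtains k where "cone n (fst p, prefix k (snd p)) \<subseteq> U"
proof -
  obtain a x where p: "p = (a, x)" by (cases p)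
  then obtain V W where VW: "openin (product_topology (\<lambda>_. discrete_topology {..<n}) UNIV) W"
    "a \<in> V" "x \<in> W" "V \<times> W \<subseteq> U"
    using assms unfolding cantor_space_def openin_prod_topology_alt by metis
  obtain Y where Y: "x \<in> PiE UNIV Y" "finite {i. Y i \<noteq> {..<n}}" "PiE UNIV Y \<subseteq> W"
    using product_topology_open_contains_basis[OF VW(1,3)] by auto
  then obtain k where k: "\<And>i. Y i \<noteq> {..<n} \<Longrightarrow> i < k"
    using finite_nat_set_iff_bounded[of "{i. Y i \<noteq> {..<n}}"] by auto
  have pC: "p \<in> cantor n r"
    using assms openin_subset topspace_cantor_space by blast
  have "q \<in> U" if q: "q \<in> cone n (a, prefix k x)" for q
  proof -
    have q': "snd q \<in> omega_words n" "fst q = a" "prefix k (snd q) = prefix k x"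
      using q mem_cone_iff[OF cone_prefix(1)[OF pC], of q k] p by (auto simp: cantor_def)
    have "snd q i \<in> Y i" for i
    proof (cases "i < k")
      case True
      then have "snd q i = x i"
        using arg_cong[OF q'(3), of "\<lambda>w. w ! i"] by simp
      then show ?thesis using Y by auto
    next
      case False
      then have "Y i = {..<n}" using k[of i] by auto
      then show ?thesis using q' by (auto simp: omega_words_def)
    qed
    then have "snd q \<in> W" using Y by auto
    then show ?thesis using VW q' by (cases q) auto
  qed
  then show ?thesis using p by (intro that[of k]) auto
qed

lemma compact_cantor_space: "compact_space (cantor_space n r)"
  unfolding cantor_space_def
  by (metis compact_space_prod_topology compact_space_product_topology
      compact_space_discrete_topology finite_lessThan)

section \<open>Prefix exchanges as homeomorphisms\<close>

lemma homeo_group_simps: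
  "carrier (homeo_group n r) = {f \<in> extensional (cantor n r).
     homeomorphic_map (cantor_space n r) (cantor_space n r) f}"
  "f \<otimes>\<^bsub>homeo_group n r\<^esub> g = compose (cantor n r) g f"
  by (simp_all add: homeo_group_def)

lemma homeo_group_bij:
  assumes "f \<in> carrier (homeo_group n r)"
  shows "bij_betw f (cantor n r) (cantor n r)"
proof -
  have f: "homeomorphic_map (cantor_space n r) (cantor_space n r) f"
    using assms by (simp add: homeo_group_def)
  show ?thesis
    using homeomorphic_imp_injective_map[OF f] homeomorphic_imp_surjective_map[OF f]
    by (simp add: topspace_cantor_space bij_betw_def)
qed

definition rooted_append :: "nat \<times> nat list \<Rightarrow> nat list \<Rightarrow> nat \<times> nat list" where
  "rooted_append u w = (fst u, snd u @ w)"

lemma rooted_append_mem [intro]: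
  "u \<in> rooted_words n r \<Longrightarrow> w \<in> lists {..<n} \<Longrightarrow> rooted_append u w \<in> rooted_words n r"
  by (auto simp: rooted_words_def rooted_append_def)

lemma rooted_conc_append: "rooted_conc (rooted_append u w) x = rooted_conc u (w \<frown> x)"
  by (simp add: rooted_conc_def rooted_append_def)

lemma rooted_prefix_append: "rooted_prefix u (rooted_append u w)"
  by (simp add: rooted_prefix_def rooted_append_def)

text \<open>The longer word is itself a truncation of \<open>p\<close>, after
  \<open>length (snd u) + k\<close> letters. This lets a word of an antichain be extended until its
  cone fits into a given neighbourhood of \<open>p\<close>, without comparing \<open>k\<close> with
  the length of \<open>u\<close>.\<close>

lemma rooted_prefix_truncate:
  assumes "p = rooted_conc u x"
  shows "rooted_prefix (fst p, prefix k (snd p)) (rooted_append u (prefix k x))"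
proof -
  have "Sublist.prefix (prefix k y) (prefix (k + l) y)" for l and y :: "nat \<Rightarrow> nat"
    by (subst subsequence_append[of y k l]) simp
  then have "Sublist.prefix (prefix k (snd p)) (prefix (length (snd u) + k) (snd p))"
    by (metis add.commute)
  then show ?thesis
    using assms prefix_conc_longer[of "snd u" x k]
    by (simp add: rooted_prefix_def rooted_append_def rooted_conc_def)
qed

lemma complete_antichainD:
  assumes "complete_antichain n r A"
  shows "finite A" "A \<subseteq> rooted_words n r" "(\<Union>u\<in>A. cone n u) = cantor n r"
    "\<And>u v. u \<in> A \<Longrightarrow> v \<in> A \<Longrightarrow> rooted_prefix u v \<Longrightarrow> u = v"
  using assms by (auto simp: complete_antichain_def)

lemma complete_antichain_cases:
  assumes "complete_antichain n r A" "p \<in> cantor n r"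
  obtains u x where "u \<in> A" "x \<in> omega_words n" "p = rooted_conc u x"
  using assms(2) unfolding complete_antichainD(3)[OF assms(1), symmetric] cone_def by auto

lemma complete_antichain_cone_unique:
  assumes "complete_antichain n r A" "u \<in> A" "v \<in> A" "p \<in> cone n u" "p \<in> cone n v"
  shows "u = v"
  using cone_inter_comparable[OF assms(4,5), of r] complete_antichainD(2,4)[OF assms(1)] assms(2,3)
  by blast

text \<open>Incomparability makes the factorisation of a point into a word of \<open>A\<close> and a
  tail unique, so the rule is well defined whatever the values of \<open>\<pi>\<close> are.\<close>

lemma prefix_exchange_exists:
  assumes A: "complete_antichain n r A"
  obtains g where "g \<in> extensional (cantor n r)" "prefix_exchange n A \<pi> g"
proof
  \<comment> \<open>The graph of the intended map, with both factorisations kept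
    existential.\<close>
  let ?P = "\<lambda>p q. \<exists>u\<in>A. \<exists>x\<in>omega_words n. p = rooted_conc u x \<and> q = rooted_conc (\<pi> u) x"
  show "prefix_exchange n A \<pi> (\<lambda>p\<in>cantor n r. THE q. ?P p q)"
    unfolding prefix_exchange_def
  proof (intro ballI)
    fix u x assume u: "u \<in> A" and x: "x \<in> omega_words n"
    have C: "rooted_conc u x \<in> cantor n r"
      using u x complete_antichainD(2)[OF A] by (auto simp: rooted_conc_mem_cantor)
    have "(THE q. ?P (rooted_conc u x) q) = rooted_conc (\<pi> u) x"
    proof (rule the_equality)
      show "?P (rooted_conc u x) (rooted_conc (\<pi> u) x)" using u x by blast
      fix q assume "?P (rooted_conc u x) q"
      then obtain v y where v: "v \<in> A" "y \<in> omega_words n" "rooted_conc u x = rooted_conc v y"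
        "q = rooted_conc (\<pi> v) y" by blast
      have "u = v"
        using complete_antichain_cone_unique[OF A u v(1), of "rooted_conc u x"] x v(2,3)
        unfolding cone_def by blast
      then show "q = rooted_conc (\<pi> u) x" using v by (simp add: rooted_conc_inject)
    qed
    then show "(\<lambda>p\<in>cantor n r. THE q. ?P p q) (rooted_conc u x) = rooted_conc (\<pi> u) x"
      using C by simp
  qed
qed auto

text \<open>Let \<open>p\<close> be \<open>u\<close> followed by \<open>x\<close>. Appending the
  first \<open>k\<close> letters of \<open>x\<close> to both \<open>u\<close> and
  \<open>\<pi> u\<close> gives a cone around \<open>p\<close> that is sent into a cone around
  \<open>g p\<close>. For suitable \<open>k\<close> the latter lies in any prescribed open
  set.\<close>

lemma prefix_exchange_continuous:
  assumes A: "complete_antichain n r A" and \<pi>: "\<pi> ` A \<subseteq> rooted_words n r"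
    and g: "prefix_exchange n A \<pi> g"
  shows "continuous_map (cantor_space n r) (cantor_space n r) g"
proof -
  have g': "g (rooted_conc u x) = rooted_conc (\<pi> u) x" if "u \<in> A" "x \<in> omega_words n" for u x
    using g that by (simp add: prefix_exchange_def)
  have maps: "g p \<in> cantor n r" if p: "p \<in> cantor n r" for p
  proof -
    obtain u x where u: "u \<in> A" "x \<in> omega_words n" "p = rooted_conc u x"
      using complete_antichain_cases[OF A p] .
    then show ?thesis using g' \<pi> rooted_conc_mem_cantor[of "\<pi> u" n r x] by auto
  qed
  have "openin (cantor_space n r) {p \<in> cantor n r. g p \<in> U}" (is "openin _ ?S")
    if U: "openin (cantor_space n r) U" for U
  proof (subst openin_subopen, intro ballI)
    fix p assume "p \<in> ?S"
    then have p: "p \<in> cantor n r" "g p \<in> U" by auto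
    obtain u x where u: "u \<in> A" "x \<in> omega_words n" "p = rooted_conc u x"
      using complete_antichain_cases[OF A p(1)] .
    have gp: "g p = rooted_conc (\<pi> u) x" using u g' by simp
    obtain k where k: "cone n (fst (g p), prefix k (snd (g p))) \<subseteq> U"
      using openin_cantor_space_cone[OF U p(2)] .
    have w: "prefix k x \<in> lists {..<n}" using u prefix_mem_lists by blast
    let ?u = "rooted_append u (prefix k x)" and ?v = "rooted_append (\<pi> u) (prefix k x)"
    have uR: "?u \<in> rooted_words n r" and vR: "?v \<in> rooted_words n r"
      using u \<pi> w complete_antichainD(2)[OF A] by auto
    have "g q \<in> U" if q: "q \<in> cone n ?u" for q
    proof -
      obtain y where y: "y \<in> omega_words n" "q = rooted_conc ?u y"
        using q by (auto simp: cone_def)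
      have "g q = rooted_conc ?v y"
        using y g'[OF u(1), of "prefix k x \<frown> y"] conc_mem_omega_words[OF w, of y]
        by (simp add: rooted_conc_append)
      then have "g q \<in> cone n ?v" using y by (auto simp: cone_def)
      then show ?thesis using k cone_mono[OF rooted_prefix_truncate[OF gp] vR] by blast
    qed
    moreover have "p \<in> cone n ?u"
      using u suffix_mem_omega_words[OF u(2), of k]
      by (auto simp: cone_def rooted_conc_append intro!: image_eqI[of _ _ "suffix k x"])
    ultimately show "\<exists>T. openin (cantor_space n r) T \<and> p \<in> T \<and> T \<subseteq> ?S"
      using openin_cone[OF uR] cone_subset_cantor[OF uR] by blast
  qed
  then show ?thesis
    using maps by (auto simp: continuous_map_def topspace_cantor_space)
qed

text \<open>The inverse is the prefix exchange along the inverse bijection from \<open>B\<close> to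
  \<open>A\<close>, so continuity of both directions comes from the same lemma.\<close>

lemma prefix_exchange_homeo_exists:
  assumes A: "complete_antichain n r A" and B: "complete_antichain n r B"
    and \<pi>: "bij_betw \<pi> A B"
  obtains g where "g \<in> carrier (homeo_group n r)" "prefix_exchange n A \<pi> g"
proof -
  let ?\<rho> = "inv_into A \<pi>"
  have \<rho>: "bij_betw ?\<rho> B A" using \<pi> by (rule bij_betw_inv_into)
  obtain f where f: "f \<in> extensional (cantor n r)" "prefix_exchange n A \<pi> f"
    using prefix_exchange_exists[OF A] .
  obtain g where g: "g \<in> extensional (cantor n r)" "prefix_exchange n B ?\<rho> g"
    using prefix_exchange_exists[OF B] .
  have cont: "continuous_map (cantor_space n r) (cantor_space n r) f"
      "continuous_map (cantor_space n r) (cantor_space n r) g"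
    using prefix_exchange_continuous[OF A _ f(2)] prefix_exchange_continuous[OF B _ g(2)]
      bij_betw_imp_surj_on[OF \<pi>] bij_betw_imp_surj_on[OF \<rho>]
      complete_antichainD(2)[OF A] complete_antichainD(2)[OF B] by simp_all
  have "g (f p) = p" if p: "p \<in> cantor n r" for p
  proof -
    obtain u x where u: "u \<in> A" "x \<in> omega_words n" "p = rooted_conc u x"
      using complete_antichain_cases[OF A p] .
    have "\<pi> u \<in> B" "?\<rho> (\<pi> u) = u"
      using \<pi> u bij_betwE[OF \<pi>] bij_betw_inv_into_left[OF \<pi>] by auto
    then show ?thesis using u f g by (simp add: prefix_exchange_def)
  qed
  moreover have "f (g p) = p" if p: "p \<in> cantor n r" for p
  proof -
    obtain u x where u: "u \<in> B" "x \<in> omega_words n" "p = rooted_conc u x"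
      using complete_antichain_cases[OF B p] .
    have "?\<rho> u \<in> A" "\<pi> (?\<rho> u) = u"
      using \<rho> u bij_betwE[OF \<rho>] bij_betw_inv_into_right[OF \<pi>] by auto
    then show ?thesis using u f g by (simp add: prefix_exchange_def)
  qed
  ultimately have "homeomorphic_maps (cantor_space n r) (cantor_space n r) f g"
    using cont by (simp add: homeomorphic_maps_def topspace_cantor_space)
  then have "f \<in> carrier (homeo_group n r)"
    using f(1) by (auto simp: homeo_group_simps homeomorphic_map_maps)
  then show ?thesis using f(2) that by blast
qed

section \<open>Complete antichains of prescribed size\<close>

lemma complete_antichain_roots: "complete_antichain n r ((\<lambda>a. (a, [])) ` {..<r})"
  by (auto simp: complete_antichain_def rooted_words_def rooted_prefix_def cone_def cantor_def
      rooted_conc_def image_iff)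

text \<open>The cone of \<open>w\<close> is the union of the cones of its one-letter extensions,
  according to the first letter of the tail. A comparability involving a new word would already give
  one between \<open>w\<close> and another word of \<open>A\<close>.\<close>

lemma complete_antichain_expand:
  assumes A: "complete_antichain n r A" and w: "w \<in> A"
  defines "C \<equiv> (\<lambda>c. rooted_append w [c]) ` {..<n}"
  shows "complete_antichain n r (A - {w} \<union> C)"
    and "0 < n \<Longrightarrow> card (A - {w} \<union> C) = card A + (n - 1)"
proof -
  note AD = complete_antichainD[OF A]
  have wR: "w \<in> rooted_words n r" using w AD by blast
  have CR: "C \<subseteq> rooted_words n r" unfolding C_def using wR by (intro image_subsetI rooted_append_mem) auto
  have wC: "rooted_prefix w v" if "v \<in> C" for v
    using that by (auto simp: C_def rooted_prefix_append)
  have below: "rooted_prefix u w" if "rooted_prefix u v" "v \<in> C" "u \<noteq> v" for u v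
    using that by (auto simp: C_def rooted_prefix_def rooted_append_def prod_eq_iff)
  have CC: "u = v" if "u \<in> C" "v \<in> C" "rooted_prefix u v" for u v
    using that by (auto simp: C_def rooted_prefix_def rooted_append_def)
  have disj: "(A - {w}) \<inter> C = {}"
    using AD(4) wC w by blast
  have inj: "inj_on (\<lambda>c. rooted_append w [c]) {..<n}"
    by (auto simp: inj_on_def rooted_append_def)
  have anti: "u = v" if uv: "u \<in> A - {w} \<union> C" "v \<in> A - {w} \<union> C" and le: "rooted_prefix u v" for u v
  proof -
    consider "u \<in> A" "v \<in> A" | "u \<in> A - {w}" "v \<in> C" | "u \<in> C" "v \<in> A - {w}"
      | "u \<in> C" "v \<in> C" using uv by blast
    from this show ?thesis
    proof cases
      case 1
      then show ?thesis using AD(4) le by blast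
    next
      case 2
      \<comment> \<open>\<open>disj\<close> separates \<open>u\<close> from \<open>v\<close>, so
        \<open>below\<close> applies. The antichain property then forces \<open>u = w\<close>, which
        contradicts the choice of \<open>u\<close>.\<close>
      then have "rooted_prefix u w" using below[OF le] disj by blast
      then show ?thesis using 2 AD(4)[of u w] w by blast
    next
      case 3
      then have "rooted_prefix w v" using rooted_prefix_trans[OF wC le] by blast
      then show ?thesis using 3 AD(4)[of w v] w by blast
    next
      case 4
      then show ?thesis using CC le by blast
    qed
  qed
  have "cone n w \<subseteq> (\<Union>v\<in>C. cone n v)"
  proof
    fix p assume "p \<in> cone n w"
    then obtain x where x: "x \<in> omega_words n" "p = rooted_conc w x" by (auto simp: cone_def)
    have "p = rooted_conc (rooted_append w [x 0]) (suffix 1 x)"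
      using x prefix_suffix[of x 1] by (simp add: rooted_conc_append)
    moreover have "suffix 1 x \<in> omega_words n" "x 0 < n"
      using x suffix_mem_omega_words by (auto simp: omega_words_iff)
    ultimately show "p \<in> (\<Union>v\<in>C. cone n v)" by (auto simp: C_def cone_def)
  qed
  moreover have "(\<Union>v\<in>C. cone n v) \<subseteq> cone n w"
    using cone_mono[OF wC] CR by blast
  ultimately have Cw: "(\<Union>v\<in>C. cone n v) = cone n w" by (rule subset_antisym[rotated])
  have "(\<Union>u\<in>A - {w} \<union> C. cone n u) = (\<Union>u\<in>A - {w}. cone n u) \<union> cone n w"
    unfolding UN_Un Cw ..
  also have "\<dots> = (\<Union>u\<in>A. cone n u)"
    by (metis UN_insert Un_commute insert_Diff w)
  finally have cover: "(\<Union>u\<in>A - {w} \<union> C. cone n u) = cantor n r" unfolding AD(3) .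
  have "finite (A - {w} \<union> C)" using AD(1) by (simp add: C_def)
  moreover have "A - {w} \<union> C \<subseteq> rooted_words n r" using AD(2) CR by blast
  ultimately show "complete_antichain n r (A - {w} \<union> C)"
    unfolding complete_antichain_def using cover anti by blast
  assume "0 < n"
  have "card (A - {w} \<union> C) = card (A - {w}) + card C"
    using AD(1) disj by (intro card_Un_disjoint) (auto simp: C_def)
  also have "\<dots> = (card A - 1) + n"
    using AD(1) w inj by (simp add: C_def card_image)
  \<comment> \<open>Both subtractions are truncated; the equality holds because \<open>A\<close>
    contains \<open>w\<close> and \<open>n\<close> is positive.\<close>
  also have "\<dots> = card A + (n - 1)"
  proof -
    have "0 < card A" using w AD(1) by (metis card_gt_0_iff empty_iff)
    then show ?thesis using \<open>0 < n\<close> by linarith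
  qed
  finally show "card (A - {w} \<union> C) = card A + (n - 1)" .
qed

text \<open>Starting from the dotted letters, the prefixes of the given word are expanded one after
  another. Each letter costs one expansion and so adds \<open>n - 1\<close> words.\<close>

lemma complete_antichain_containing:
  assumes "0 < n" "(a, w) \<in> rooted_words n r"
  shows "\<exists>A. complete_antichain n r A \<and> (a, w) \<in> A \<and> card A = r + length w * (n - 1)"
  using assms(2)
proof (induction w rule: rev_induct)
  case Nil
  have "card ((\<lambda>a. (a, [] :: nat list)) ` {..<r}) = r"
    by (simp add: card_image inj_on_def)
  then show ?case
    using Nil complete_antichain_roots[of n r] by (auto simp: rooted_words_def)
next
  case (snoc c w)
  then have "(a, w) \<in> rooted_words n r" and c: "c < n" by (auto simp: rooted_words_def)
  then obtain A where A: "complete_antichain n r A" "(a, w) \<in> A" "card A = r + length w * (n - 1)"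
    using snoc by blast
  show ?case
  proof (intro exI conjI)
    let ?A = "A - {(a, w)} \<union> (\<lambda>c. rooted_append (a, w) [c]) ` {..<n}"
    show "complete_antichain n r ?A" using A(1,2) by (rule complete_antichain_expand)
    show "(a, w @ [c]) \<in> ?A" using c by (simp add: rooted_append_def)
    show "card ?A = r + length (w @ [c]) * (n - 1)"
      unfolding complete_antichain_expand(2)[OF A(1,2) assms(1)] A(3) by simp
  qed
qed

text \<open>The size is raised by expanding a word other than the given one. Such a word exists
  because \<open>w \<noteq> []\<close> and \<open>2 \<le> n\<close> force more than one element. For
  \<open>r = 1\<close> the bare dotted letter would have to be excluded: it is alone in its
  antichain.\<close>

lemma complete_antichain_containing_large:
  assumes n: "2 \<le> n" and u: "(a, w) \<in> rooted_words n r" and w: "w \<noteq> []"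
  shows "\<exists>A. complete_antichain n r A \<and> (a, w) \<in> A \<and> card A = r + (length w + m) * (n - 1)"
proof (induction m)
  case 0
  have "0 < n" using n by simp
  then show ?case unfolding add_0_right using u by (rule complete_antichain_containing)
next
  case (Suc m)
  then obtain A where A: "complete_antichain n r A" "(a, w) \<in> A"
    "card A = r + (length w + m) * (n - 1)" by blast
  have "0 < (length w + m) * (n - 1)" using w n by simp
  moreover have "0 < r" using u by (auto simp: rooted_words_def)
  ultimately have "1 < card A" unfolding A(3) by linarith
  then have "A \<noteq> {(a, w)}" by auto
  then obtain v where v: "v \<in> A" "v \<noteq> (a, w)" using A(2) by blast
  have "0 < n" using n by simp
  show ?case
  proof (intro exI conjI)
    let ?A = "A - {v} \<union> (\<lambda>c. rooted_append v [c]) ` {..<n}"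
    show "complete_antichain n r ?A" using A(1) v(1) by (rule complete_antichain_expand)
    show "(a, w) \<in> ?A" using A(2) v(2) by simp
    show "card ?A = r + (length w + Suc m) * (n - 1)"
      unfolding complete_antichain_expand(2)[OF A(1) v(1) \<open>0 < n\<close>] A(3) by simp
  qed
qed

section \<open>Prefix replacements realised in \<open>Higman_T\<close>\<close>

text \<open>Since \<open>lex_less\<close> is a strict linear order on all pairs, the sorted list of
  a finite set supplies the listing.\<close>

lemma lex_listing_exists:
  assumes "finite A"
  obtains us where "lex_listing us A" "distinct us" "length us = card A"
proof -
  have irr: "\<not> lex_less u u" for u
    using lexord_irreflexive[of less_than "snd u"] by (cases u) (auto simp: lex_less_def)
  have trans: "lex_less u v \<Longrightarrow> lex_less v w \<Longrightarrow> lex_less u w" for u v w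
    unfolding lex_less_def
    using trans_lex_prod[OF trans_less_than lexord_transI[OF trans_less_than]] by (auto dest: transD)
  have total: "lex_less u v \<or> u = v \<or> lex_less v u" for u v
    using lexord_linear[of less_than "snd u" "snd v"] linorder_less_linear
    by (cases u; cases v) (auto simp: lex_less_def)
  interpret lex: linorder "\<lambda>u v. lex_less u v \<or> u = v" lex_less
    by unfold_locales (use irr trans total in blast)+
  show ?thesis
    using that[of "lex.sorted_list_of_set A"] assms lex.strict_sorted_list_of_set[of A]
    by (simp add: lex_listing_def)
qed

text \<open>Put \<open>u\<close> and \<open>v\<close> into complete antichains of equal size. Some
  cyclic rotation of the indices moves the position of \<open>u\<close> to that of \<open>v\<close>,
  and the prefix exchange along it is the required element.\<close>

lemma Higman_T_prefix_replacement:
  assumes n: "2 \<le> n"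
    and u: "u \<in> rooted_words n r" "snd u \<noteq> []" and v: "v \<in> rooted_words n r" "snd v \<noteq> []"
  obtains t where "t \<in> Higman_T n r"
    "\<And>x. x \<in> omega_words n \<Longrightarrow> t (rooted_conc u x) = rooted_conc v x"
proof -
  obtain a w b w' where uv: "u = (a, w)" "v = (b, w')" by (cases u; cases v)
  \<comment> \<open>Each antichain is enlarged by the length of the other word, which makes the two
    cardinalities agree.\<close>
  obtain A where A: "complete_antichain n r A" "u \<in> A" "card A = r + (length w + length w') * (n - 1)"
    using complete_antichain_containing_large[OF n, of a w r "length w'"] u uv by auto
  obtain B where B: "complete_antichain n r B" "v \<in> B" "card B = r + (length w' + length w) * (n - 1)"
    using complete_antichain_containing_large[OF n, of b w' r "length w"] v uv by auto
  obtain us where us: "lex_listing us A" "distinct us" "length us = card A"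
    using lex_listing_exists complete_antichainD(1)[OF A(1)] by blast
  obtain vs where vs: "lex_listing vs B" "distinct vs" "length vs = card B"
    using lex_listing_exists complete_antichainD(1)[OF B(1)] by blast
  define l where "l = card A"
  have l: "length us = l" "length vs = l" using us vs A(3) B(3) by (simp_all add: l_def add.commute)
  have bus: "bij_betw ((!) us) {..<l} A" and bvs: "bij_betw ((!) vs) {..<l} B"
    using us vs l by (auto simp: lex_listing_def intro!: bij_betw_nth)
  obtain i where i: "i < l" "us ! i = u" using A(2) bus unfolding bij_betw_def by auto
  obtain k where k: "k < l" "vs ! k = v" using B(2) bvs unfolding bij_betw_def by auto
  \<comment> \<open>The shift should be \<open>k - i\<close> modulo \<open>l\<close>; adding
    \<open>l\<close> first keeps it a natural number, and \<open>i + j = k + l\<close> reduces to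
    \<open>k\<close>.\<close>
  define j where "j = k + (l - i)"
  have "inj_on (\<lambda>m. (m + j) mod l) {..<l}"
  proof (rule inj_onI)
    fix m m' assume m: "m \<in> {..<l}" "m' \<in> {..<l}" "(m + j) mod l = (m' + j) mod l"
    \<comment> \<open>The congruence is rewritten as an equation without subtraction, so that
      \<open>j\<close> cancels; \<open>m\<close> and \<open>m'\<close> are their own
      residues.\<close>
    then obtain q q' where "m + j + l * q = m' + j + l * q'"
      unfolding nat_mod_eq_iff by blast
    then have "(m + l * q) mod l = (m' + l * q') mod l" by simp
    then show "m = m'" using m by simp
  qed
  moreover have "(\<lambda>m. (m + j) mod l) ` {..<l} \<subseteq> {..<l}" using i by auto
  ultimately have rot: "bij_betw (\<lambda>m. (m + j) mod l) {..<l} {..<l}"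
    by (simp add: bij_betw_def endo_inj_surj)
  \<comment> \<open>Look up the position in \<open>us\<close>, rotate it, and read off the word of
    \<open>vs\<close> there.\<close>
  define \<pi> where "\<pi> = (!) vs \<circ> (\<lambda>m. (m + j) mod l) \<circ> inv_into {..<l} ((!) us)"
  have \<pi>: "bij_betw \<pi> A B"
    unfolding \<pi>_def using bij_betw_inv_into[OF bus] rot bvs by (blast intro: bij_betw_trans)
  have \<pi>_nth: "\<pi> (us ! m) = vs ! ((m + j) mod l)" if "m < l" for m
    using bij_betw_inv_into_left[OF bus] that by (simp add: \<pi>_def)
  have "i + j = k + l" using i by (simp add: j_def)
  then have \<pi>u: "\<pi> u = v" using \<pi>_nth[OF i(1)] i k by simp
  obtain t where t: "t \<in> carrier (homeo_group n r)" "prefix_exchange n A \<pi> t"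
    using prefix_exchange_homeo_exists[OF A(1) B(1) \<pi>] .
  have "t \<in> Higman_T n r"
    unfolding Higman_T_def
  proof (intro CollectI conjI exI)
    show "\<forall>i<length us. \<pi> (us ! i) = vs ! ((i + j) mod length us)" using \<pi>_nth l by simp
  qed (fact t A(1) B(1) \<pi> us(1) vs(1))+
  moreover have "t (rooted_conc u x) = rooted_conc v x" if "x \<in> omega_words n" for x
    using t(2) A(2) \<pi>u that by (simp add: prefix_exchange_def)
  ultimately show ?thesis by (rule that)
qed

text \<open>Near \<open>p\<close> the map \<open>g\<close> replaces one prefix by another.
  Prolonging both prefixes by the next letter of \<open>p\<close> rules out bare dotted letters, so
  the replacement extends to an element of \<open>Higman_T\<close>.\<close>

lemma Higman_G_locally_T:
  assumes n: "2 \<le> n" and g: "g \<in> Higman_G n r" and p: "p \<in> cantor n r"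
  obtains t U where "t \<in> Higman_T n r" "openin (cantor_space n r) U" "p \<in> U"
    "\<And>q. q \<in> U \<Longrightarrow> g q = t q"
proof -
  obtain A B \<pi> where A: "complete_antichain n r A" "complete_antichain n r B"
    "bij_betw \<pi> A B" "prefix_exchange n A \<pi> g"
    using g unfolding Higman_G_def by blast
  obtain u x where u: "u \<in> A" "x \<in> omega_words n" "p = rooted_conc u x"
    using complete_antichain_cases[OF A(1) p] .
  have x0: "[x 0] \<in> lists {..<n}" using u by (simp add: omega_words_iff)
  let ?u = "rooted_append u [x 0]" and ?v = "rooted_append (\<pi> u) [x 0]"
  have "u \<in> rooted_words n r" "\<pi> u \<in> rooted_words n r"
    using u complete_antichainD(2)[OF A(1)] complete_antichainD(2)[OF A(2)] bij_betwE[OF A(3)]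
    by auto
  then have R: "?u \<in> rooted_words n r" "?v \<in> rooted_words n r"
    using x0 by auto
  have ne: "snd ?u \<noteq> []" "snd ?v \<noteq> []" by (simp_all add: rooted_append_def)
  obtain t where t: "t \<in> Higman_T n r"
    "\<And>y. y \<in> omega_words n \<Longrightarrow> t (rooted_conc ?u y) = rooted_conc ?v y"
    using Higman_T_prefix_replacement[OF n R(1) ne(1) R(2) ne(2)] by blast
  have "g q = t q" if q: "q \<in> cone n ?u" for q
  proof -
    obtain y where y: "y \<in> omega_words n" "q = rooted_conc ?u y"
      using q by (auto simp: cone_def)
    have "g q = rooted_conc ?v y"
      using A(4) u y conc_mem_omega_words[OF x0, of y]
      by (simp add: rooted_conc_append prefix_exchange_def)
    then show ?thesis using t(2) y by simp
  qed
  moreover have "p \<in> cone n ?u"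
  proof -
    have "p = rooted_conc ?u (suffix 1 x)"
      using u prefix_suffix[of x 1] by (simp add: rooted_conc_append)
    then show ?thesis using u suffix_mem_omega_words by (auto simp: cone_def)
  qed
  ultimately show ?thesis using t(1) openin_cone[OF R(1)] that by blast
qed

section \<open>Membership in \<open>Higman_G\<close> as a local property\<close>

text \<open>Only the prefix-minimal words of \<open>F\<close> are kept. They still cover: among the
  words of \<open>F\<close> whose cones contain a point, a shortest one is minimal, because the cone
  of any prefix of it contains the point too.\<close>

lemma complete_antichain_subset_cover:
  assumes F: "finite F" "F \<subseteq> rooted_words n r" "cantor n r \<subseteq> (\<Union>u\<in>F. cone n u)"
  obtains A where "A \<subseteq> F" "complete_antichain n r A"
proof
  let ?A = "{u \<in> F. \<forall>v\<in>F. rooted_prefix v u \<longrightarrow> v = u}"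
  show "?A \<subseteq> F" by blast
  have "\<exists>u\<in>?A. p \<in> cone n u" if p: "p \<in> cantor n r" for p
  proof -
    obtain v\<^sub>0 where "v\<^sub>0 \<in> F \<and> p \<in> cone n v\<^sub>0" using F(3) p by blast
    from ex_has_least_nat[of "\<lambda>v. v \<in> F \<and> p \<in> cone n v", OF this, of "\<lambda>v. length (snd v)"]
    obtain v where v: "v \<in> F" "p \<in> cone n v"
      "\<And>v'. v' \<in> F \<Longrightarrow> p \<in> cone n v' \<Longrightarrow> length (snd v) \<le> length (snd v')"
      by blast
    have "w = v" if w: "w \<in> F" "rooted_prefix w v" for w
    proof -
      have "p \<in> cone n w" using cone_mono[OF w(2)] v F(2) by blast
      then have "length (snd v) \<le> length (snd w)" using v w by blast
      then show ?thesis
        using w(2) by (auto simp: rooted_prefix_def prod_eq_iff Sublist.prefix_def)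
    qed
    then show ?thesis using v by blast
  qed
  moreover have "cone n u \<subseteq> cantor n r" if "u \<in> ?A" for u
    using cone_subset_cantor F(2) that by blast
  ultimately have "(\<Union>u\<in>?A. cone n u) = cantor n r" by blast
  then show "complete_antichain n r ?A"
    unfolding complete_antichain_def using F(1,2) by auto
qed

text \<open>Compactness yields a finite cover by cones on which \<open>g\<close> is a single prefix
  replacement, and thinning it gives the domain antichain. The image words form a complete antichain
  because \<open>g\<close> is a bijection: injectivity gives incomparability and surjectivity gives
  the covering.\<close>

lemma Higman_G_I_locally:
  assumes n: "0 < n" and g: "g \<in> carrier (homeo_group n r)"
    and loc: "\<And>p. p \<in> cantor n r \<Longrightarrow>
      \<exists>t\<in>Higman_G n r. \<exists>U. openin (cantor_space n r) U \<and> p \<in> U \<and> (\<forall>q\<in>U. g q = t q)"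
  shows "g \<in> Higman_G n r"
proof -
  \<comment> \<open>These are the words on whose entire cone \<open>g\<close> acts by one prefix
    replacement.\<close>
  define E where "E = {u \<in> rooted_words n r. \<exists>v\<in>rooted_words n r.
    \<forall>x\<in>omega_words n. g (rooted_conc u x) = rooted_conc v x}"
  have ER: "E \<subseteq> rooted_words n r" by (auto simp: E_def)
  have cover: "\<exists>u\<in>E. p \<in> cone n u" if p: "p \<in> cantor n r" for p
  proof -
    obtain t U where t: "t \<in> Higman_G n r" and U: "openin (cantor_space n r) U" "p \<in> U"
      and gt: "\<And>q. q \<in> U \<Longrightarrow> g q = t q"
      using loc[OF p] by blast
    obtain A B \<pi> where A: "complete_antichain n r A" "complete_antichain n r B"
      "bij_betw \<pi> A B" "prefix_exchange n A \<pi> t"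
      using t unfolding Higman_G_def by blast
    obtain u x where u: "u \<in> A" "x \<in> omega_words n" "p = rooted_conc u x"
      using complete_antichain_cases[OF A(1) p] .
    obtain k where k: "cone n (fst p, prefix k (snd p)) \<subseteq> U"
      using openin_cantor_space_cone[OF U] .
    have w: "prefix k x \<in> lists {..<n}" using u prefix_mem_lists by blast
    \<comment> \<open>The word \<open>u\<close> is prolonged along \<open>p\<close> until its cone
      lies in \<open>U\<close>, where \<open>g\<close> coincides with \<open>t\<close>; the
      replacing word receives the same letters.\<close>
    let ?u = "rooted_append u (prefix k x)" and ?v = "rooted_append (\<pi> u) (prefix k x)"
    have "u \<in> rooted_words n r" "\<pi> u \<in> rooted_words n r"
      using u complete_antichainD(2)[OF A(1)] complete_antichainD(2)[OF A(2)] bij_betwE[OF A(3)]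
      by auto
    then have R: "?u \<in> rooted_words n r" "?v \<in> rooted_words n r"
      using w by auto
    have uU: "cone n ?u \<subseteq> U"
      using cone_mono[OF rooted_prefix_truncate[OF u(3)] R(1)] k by blast
    have "g (rooted_conc ?u y) = rooted_conc ?v y" if y: "y \<in> omega_words n" for y
    proof -
      have "rooted_conc ?u y \<in> U" using uU y by (auto simp: cone_def)
      then have "g (rooted_conc ?u y) = t (rooted_conc ?u y)" by (rule gt)
      also have "\<dots> = rooted_conc ?v y"
        using A(4) u y conc_mem_omega_words[OF w, of y]
        by (simp add: rooted_conc_append prefix_exchange_def)
      finally show ?thesis .
    qed
    then have "?u \<in> E" using R by (auto simp: E_def)
    moreover have "p = rooted_conc ?u (suffix k x)"
      using u prefix_suffix[of x k] by (simp add: rooted_conc_append)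
    then have "p \<in> cone n ?u" using u suffix_mem_omega_words by (auto simp: cone_def)
    ultimately show ?thesis by blast
  qed
  have "\<exists>\<F>. finite \<F> \<and> \<F> \<subseteq> cone n ` E \<and> cantor n r \<subseteq> \<Union>\<F>"
  proof (rule mp[OF spec[OF iffD1[OF compact_space_alt compact_cantor_space[of n r],
          unfolded topspace_cantor_space]]], intro conjI ballI)
    show "openin (cantor_space n r) U" if "U \<in> cone n ` E" for U
      using that openin_cone ER by blast
    show "cantor n r \<subseteq> \<Union>(cone n ` E)" using cover by blast
  qed
  then obtain \<F> where \<F>: "finite \<F>" "\<F> \<subseteq> cone n ` E" "cantor n r \<subseteq> \<Union>\<F>"
    by blast
  obtain F where F: "finite F" "F \<subseteq> E" "cantor n r \<subseteq> (\<Union>u\<in>F. cone n u)"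
    using finite_subset_image[OF \<F>(1,2)] \<F>(3) by blast
  obtain A where A: "A \<subseteq> F" "complete_antichain n r A"
    using complete_antichain_subset_cover[OF F(1) _ F(3)] F(2) ER by blast
  then have "\<forall>u\<in>A. \<exists>v\<in>rooted_words n r. \<forall>x\<in>omega_words n. g (rooted_conc u x) = rooted_conc v x"
    using F(2) by (auto simp: E_def)
  then obtain \<pi> where \<pi>: "\<And>u. u \<in> A \<Longrightarrow> \<pi> u \<in> rooted_words n r"
    "\<And>u x. u \<in> A \<Longrightarrow> x \<in> omega_words n \<Longrightarrow> g (rooted_conc u x) = rooted_conc (\<pi> u) x"
    by metis
  note AD = complete_antichainD[OF A(2)]
  note bij = homeo_group_bij[OF g]
  have img: "cone n (\<pi> u) = g ` cone n u" if "u \<in> A" for u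
    using \<pi>(2)[OF that] by (auto simp: cone_def image_iff)
  have incomp: "u = v" if u: "u \<in> A" and v: "v \<in> A" and le: "rooted_prefix (\<pi> u) (\<pi> v)" for u v
  proof -
    \<comment> \<open>A sample point of the smaller image cone, available since
      \<open>0 < n\<close>. It has a preimage in the cone of \<open>u\<close> and one in the cone of
      \<open>v\<close>; these coincide by injectivity of \<open>g\<close>, so the two cones
      meet.\<close>
    let ?q = "rooted_conc (\<pi> v) (\<lambda>_. 0)"
    have qv: "?q \<in> cone n (\<pi> v)" using omega_words_nonempty[OF n] by (auto simp: cone_def)
    then have qu: "?q \<in> cone n (\<pi> u)" using cone_mono[OF le] \<pi>(1)[OF v] by blast
    obtain p where p: "p \<in> cone n v" "g p = ?q"
      using qv unfolding img[OF v] by (rule imageE) simp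
    obtain p' where p': "p' \<in> cone n u" "g p' = ?q"
      using qu unfolding img[OF u] by (rule imageE) simp
    have "p \<in> cantor n r" "p' \<in> cantor n r"
      using p(1) p'(1) u v AD(3) by blast+
    then have "p = p'"
      using inj_onD[OF bij_betw_imp_inj_on[OF bij]] p(2) p'(2) by simp
    then show "u = v"
      using complete_antichain_cone_unique[OF A(2) u v] p(1) p'(1) by blast
  qed
  have \<pi>_bij: "bij_betw \<pi> A (\<pi> ` A)"
  proof (rule inj_on_imp_bij_betw, rule inj_onI)
    fix u v assume uv: "u \<in> A" "v \<in> A" "\<pi> u = \<pi> v"
    show "u = v" using incomp[OF uv(1,2)] rooted_prefix_refl[of "\<pi> v"] uv(3) by simp
  qed
  have "(\<Union>v\<in>\<pi> ` A. cone n v) = g ` (\<Union>u\<in>A. cone n u)"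
    using img by auto
  also have "\<dots> = cantor n r"
    unfolding AD(3) using bij by (rule bij_betw_imp_surj_on)
  finally have "(\<Union>v\<in>\<pi> ` A. cone n v) = cantor n r" .
  moreover have "\<not> rooted_prefix x y" if "x \<in> \<pi> ` A" "y \<in> \<pi> ` A" "x \<noteq> y" for x y
    using that incomp by (elim imageE) metis
  ultimately have "complete_antichain n r (\<pi> ` A)"
    unfolding complete_antichain_def using AD(1) \<pi>(1) by (simp add: image_subset_iff)
  moreover have "prefix_exchange n A \<pi> g"
    using \<pi>(2) by (simp add: prefix_exchange_def)
  ultimately show ?thesis
    unfolding Higman_G_def mem_Collect_eq using g A(2) \<pi>_bij by meson
qed

section \<open>Normalisers and conjugation\<close>

text \<open>The library normaliser is a stabiliser for conjugation of subsets by cosets; this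
  unfolds it into an equality of sets of conjugated elements.\<close>

lemma normalizer_iff:
  assumes "group G" "H \<subseteq> carrier G"
  shows "h \<in> normalizer G H \<longleftrightarrow>
    h \<in> carrier G \<and> (\<lambda>x. h \<otimes>\<^bsub>G\<^esub> x \<otimes>\<^bsub>G\<^esub> inv\<^bsub>G\<^esub> h) ` H = H"
proof -
  have "h <#\<^bsub>G\<^esub> H #>\<^bsub>G\<^esub> inv\<^bsub>G\<^esub> h = (\<lambda>x. h \<otimes>\<^bsub>G\<^esub> x \<otimes>\<^bsub>G\<^esub> inv\<^bsub>G\<^esub> h) ` H"
    by (auto simp: l_coset_def r_coset_def)
  then show ?thesis
    using assms(2) by (simp add: normalizer_def stabilizer_def)
qed

text \<open>If \<open>g\<close> agrees with \<open>t\<close> near \<open>h p\<close>, then their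
  conjugates agree near \<open>p\<close>. The conjugate of \<open>t\<close> stays in
  \<open>Higman_T\<close>, hence in \<open>Higman_G\<close>, and the local criterion
  applies.\<close>

lemma conjugate_in_Higman_G:
  assumes n: "2 \<le> n" and h: "h \<in> normalizer (homeo_group n r) (Higman_T n r)"
    and g: "g \<in> Higman_G n r"
  shows "h \<otimes>\<^bsub>homeo_group n r\<^esub> g \<otimes>\<^bsub>homeo_group n r\<^esub> inv\<^bsub>homeo_group n r\<^esub> h \<in> Higman_G n r"
proof -
  let ?H = "homeo_group n r"
  interpret H: group ?H by (rule group_homeo_group)
  have T: "Higman_T n r \<subseteq> carrier ?H"
    using Higman_T_subset_G Higman_G_subset by blast
  have hC: "h \<in> carrier ?H" and hT: "(\<lambda>t. h \<otimes>\<^bsub>?H\<^esub> t \<otimes>\<^bsub>?H\<^esub> inv\<^bsub>?H\<^esub> h) ` Higman_T n r = Higman_T n r"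
    using h normalizer_iff[OF H.is_group T] by auto
  have gC: "g \<in> carrier ?H" using g Higman_G_subset by blast
  \<comment> \<open>Products act from left to right, so \<open>h\<close> is applied first and its
    inverse last. This is why \<open>g\<close> is approximated at \<open>h p\<close>.\<close>
  have conj: "(h \<otimes>\<^bsub>?H\<^esub> k \<otimes>\<^bsub>?H\<^esub> inv\<^bsub>?H\<^esub> h) p = (inv\<^bsub>?H\<^esub> h) (k (h p))" if "p \<in> cantor n r" for k p
    using that by (simp add: homeo_group_simps(2) compose_def)
  have cont: "continuous_map (cantor_space n r) (cantor_space n r) h"
    using hC by (auto simp: homeo_group_simps homeomorphic_imp_continuous_map)
  show ?thesis
  proof (rule Higman_G_I_locally)
    show "0 < n" using n by simp
    show "h \<otimes>\<^bsub>?H\<^esub> g \<otimes>\<^bsub>?H\<^esub> inv\<^bsub>?H\<^esub> h \<in> carrier ?H" using hC gC by simp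
    fix p assume p: "p \<in> cantor n r"
    then have hp: "h p \<in> cantor n r" using bij_betwE[OF homeo_group_bij[OF hC]] by blast
    obtain t U where t: "t \<in> Higman_T n r" and U: "openin (cantor_space n r) U" "h p \<in> U"
      and gt: "\<And>q. q \<in> U \<Longrightarrow> g q = t q"
      using Higman_G_locally_T[OF n g hp] by blast
    \<comment> \<open>Pulling \<open>U\<close> back along the continuous map \<open>h\<close> gives
      the neighbourhood of \<open>p\<close> on which the two conjugates agree.\<close>
    let ?V = "{q \<in> cantor n r. h q \<in> U}"
    have "h \<otimes>\<^bsub>?H\<^esub> t \<otimes>\<^bsub>?H\<^esub> inv\<^bsub>?H\<^esub> h \<in> Higman_G n r"
      using hT t Higman_T_subset_G by blast
    moreover have "openin (cantor_space n r) ?V"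
      using openin_continuous_map_preimage[OF cont U(1)] by (simp add: topspace_cantor_space)
    moreover have "p \<in> ?V" using p U by blast
    moreover have "\<forall>q\<in>?V. (h \<otimes>\<^bsub>?H\<^esub> g \<otimes>\<^bsub>?H\<^esub> inv\<^bsub>?H\<^esub> h) q = (h \<otimes>\<^bsub>?H\<^esub> t \<otimes>\<^bsub>?H\<^esub> inv\<^bsub>?H\<^esub> h) q"
      using gt by (simp add: conj)
    ultimately show "\<exists>t\<in>Higman_G n r. \<exists>U. openin (cantor_space n r) U \<and> p \<in> U \<and>
        (\<forall>q\<in>U. (h \<otimes>\<^bsub>?H\<^esub> g \<otimes>\<^bsub>?H\<^esub> inv\<^bsub>?H\<^esub> h) q = t q)"
      by blast
  qed
qed

text \<open>Conjugation by \<open>h\<close> maps \<open>Higman_G\<close> into itself; equality of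
  sets follows because the inverse of \<open>h\<close> also normalises \<open>Higman_T\<close>. Both
  normalisers are subgroups of the homeomorphism group, so the inclusion between them is all that
  remains.\<close>

theorem corollary1p2:
  fixes n r :: nat
  assumes "2 \<le> n" and "1 \<le> r" and "r \<le> n - 1"
  shows "subgroup (normalizer (homeo_group n r) (Higman_T n r))
           ((homeo_group n r)\<lparr>carrier := normalizer (homeo_group n r) (Higman_G n r)\<rparr>)"
proof -
  let ?H = "homeo_group n r"
  interpret H: group ?H by (rule group_homeo_group)
  have T: "Higman_T n r \<subseteq> carrier ?H"
    using Higman_T_subset_G Higman_G_subset by blast
  have NT: "subgroup (normalizer ?H (Higman_T n r)) ?H"
    using T by (rule H.normalizer_imp_subgroup)
  have NG: "subgroup (normalizer ?H (Higman_G n r)) ?H"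
    using Higman_G_subset by (rule H.normalizer_imp_subgroup)
  have "h \<in> normalizer ?H (Higman_G n r)" if h: "h \<in> normalizer ?H (Higman_T n r)" for h
  proof -
    have hC: "h \<in> carrier ?H" using subgroup.mem_carrier[OF NT h] .
    have "g \<in> (\<lambda>x. h \<otimes>\<^bsub>?H\<^esub> x \<otimes>\<^bsub>?H\<^esub> inv\<^bsub>?H\<^esub> h) ` Higman_G n r" if g: "g \<in> Higman_G n r" for g
    proof
      \<comment> \<open>The preimage of \<open>g\<close> under conjugation by \<open>h\<close> is
        its conjugate by the inverse of \<open>h\<close>.\<close>
      let ?k = "inv\<^bsub>?H\<^esub> h \<otimes>\<^bsub>?H\<^esub> g \<otimes>\<^bsub>?H\<^esub> h"
      have gC: "g \<in> carrier ?H" using g Higman_G_subset by blast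
      show "?k \<in> Higman_G n r"
        using conjugate_in_Higman_G[OF assms(1) subgroup.m_inv_closed[OF NT h] g] hC by simp
      show "g = h \<otimes>\<^bsub>?H\<^esub> ?k \<otimes>\<^bsub>?H\<^esub> inv\<^bsub>?H\<^esub> h"
        using hC gC by (simp add: H.m_assoc) (simp add: H.m_assoc[symmetric])
    qed
    then show ?thesis
      using hC conjugate_in_Higman_G[OF assms(1) h]
      unfolding normalizer_iff[OF H.is_group Higman_G_subset] by blast
  qed
  then show ?thesis using H.subgroup_incl[OF NT NG] by blast
qed

end
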